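(* Let $k\geq 2$ be an integer and let $G=(D\cup I,E)$ be a split graph such that $H(G)$ admits a panchromatic $k$-coloring, and let $\alpha=\alpha_k(H(G))$. Then $G$ has $k-\lceil \alpha/2\rceil$ completely independent spanning trees. Moreover, if $H(G)$ is not $k$-uniform and there is a panchromatic $k$-coloring of $H(G)$ for which there is only one unique color $c_j$ and, for each color $c_i\neq c_j$, there exists a vertex $y\in I$ with $d_G(y)>k$ adjacent to at least two vertices of color $c_i$, then $G$ has $k-\lceil \alpha/2\rceil+1$ completely independent spanning trees.
   Context: A split graph $G=(D\cup I,E)$ is a graph whose vertex set is partitioned into a clique $D$ and an independent set $I$; the paper assumes throughout that every vertex of $D$ is adjacent to at least one vertex of $I$. Its corresponding hypergraph is $H(G)=(D,\mathcal{E})$ with $\mathcal{E}=\{N_G(x) : x\in I\}$ (one hyperedge for each $x\in I$); it is $k$-uniform if every vertex of $I$ has exactly $k$ neighbors. $d_G(y)$ is the degree of $y$. A panchromatic $k$-coloring of a hypergraph is an assignment of colors from $\{1,\dots,k\}$ to its vertices such that every hyperedge contains at least one vertex of each of the $k$ colors. A color is unique if it is assigned to exactly one vertex. $\alpha_k(H)$ is the minimum, over all panchromatic $k$-colorings of $H$, of the number of vertices whose color is unique. Spanning trees $T_1,\dots,T_m$ of a graph are completely independent spanning trees if for every pair of vertices $x,y$ the $(x,y)$-paths in $T_1,\dots,T_m$ are pairwise edge-disjoint and have no common internal vertex (for $m=1$ this just means a spanning tree).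
   Formalization: In the "moreover" part the coloring with only one unique color is also required to attain the minimum α (so α=1); without this the claim fails, e.g. k=2, G=K_5 with |D|=4, |I|=1, where α=0 and 3 trees would need 12 of 10 edges. *)

theory Defs
  imports Complex_Main "HOL-Library.Multiset"
begin

(* A graph is given by its vertex set V and its edge set E of two-element subsets of V.
   The Graph_Theory entry of the AFP is not used: it calls a digraph a tree if it is connected
   and has no directed cycle, which neither accepts symmetric digraphs with an edge (u, v, u is
   a cycle there) nor rejects acyclically oriented undirected cycles. *)

definition fin_simple_graph :: "'a set \<Rightarrow> 'a set set \<Rightarrow> bool" where
  "fin_simple_graph V E \<longleftrightarrow> finite V \<and> (\<forall>e\<in>E. \<exists>u\<in>V. \<exists>v\<in>V. u \<noteq> v \<and> e = {u, v})"

definition nbhd :: "'a set set \<Rightarrow> 'a \<Rightarrow> 'a set" where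
  "nbhd E x = {y. {x, y} \<in> E}"

definition degree :: "'a set set \<Rightarrow> 'a \<Rightarrow> nat" where
  "degree E x = card (nbhd E x)"

definition path_edges :: "'a list \<Rightarrow> 'a set set" where
  "path_edges p = {{p ! i, p ! Suc i} |i. Suc i < length p}"

definition is_path :: "'a set \<Rightarrow> 'a set set \<Rightarrow> 'a \<Rightarrow> 'a list \<Rightarrow> 'a \<Rightarrow> bool" where
  "is_path V E x p y \<longleftrightarrow>
     p \<noteq> [] \<and> hd p = x \<and> last p = y \<and> distinct p \<and> set p \<subseteq> V \<and> path_edges p \<subseteq> E"

definition internal_verts :: "'a list \<Rightarrow> 'a set" where
  "internal_verts p = set p - {hd p, last p}"

definition is_connected :: "'a set \<Rightarrow> 'a set set \<Rightarrow> bool" where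
  "is_connected V E \<longleftrightarrow> (\<forall>x\<in>V. \<forall>y\<in>V. \<exists>p. is_path V E x p y)"

definition is_cycle :: "'a set set \<Rightarrow> 'a list \<Rightarrow> bool" where
  "is_cycle E p \<longleftrightarrow>
     length p \<ge> 3 \<and> distinct p \<and> path_edges p \<subseteq> E \<and> {last p, hd p} \<in> E"

(* A spanning tree has vertex set V, so it is identified with its edge set. *)
definition is_spanning_tree :: "'a set \<Rightarrow> 'a set set \<Rightarrow> 'a set set \<Rightarrow> bool" where
  "is_spanning_tree V E T \<longleftrightarrow> T \<subseteq> E \<and> is_connected V T \<and> (\<nexists>p. is_cycle T p)"

definition completely_independent ::
  "'a set \<Rightarrow> 'a set set \<Rightarrow> nat \<Rightarrow> (nat \<Rightarrow> 'a set set) \<Rightarrow> bool" where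
  "completely_independent V E m T \<longleftrightarrow>
     (\<forall>i\<in>{1..m}. is_spanning_tree V E (T i)) \<and>
     (\<forall>i\<in>{1..m}. \<forall>j\<in>{1..m}. i \<noteq> j \<longrightarrow>
        (\<forall>x\<in>V. \<forall>y\<in>V. \<forall>p q. is_path V (T i) x p y \<longrightarrow> is_path V (T j) x q y \<longrightarrow>
           path_edges p \<inter> path_edges q = {} \<and> internal_verts p \<inter> internal_verts q = {}))"

definition has_CISTs :: "'a set \<Rightarrow> 'a set set \<Rightarrow> nat \<Rightarrow> bool" where
  "has_CISTs V E m \<longleftrightarrow> (\<exists>T. completely_independent V E m T)"

definition split_graph :: "'a set \<Rightarrow> 'a set \<Rightarrow> 'a set set \<Rightarrow> bool" where
  "split_graph D I E \<longleftrightarrow>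
     fin_simple_graph (D \<union> I) E \<and> D \<inter> I = {} \<and>
     (\<forall>u\<in>D. \<forall>v\<in>D. u \<noteq> v \<longrightarrow> {u, v} \<in> E) \<and>
     (\<forall>u\<in>I. \<forall>v\<in>I. {u, v} \<notin> E)"

(* Hyperedges form a multiset: different vertices of I may have the same neighbourhood. *)
type_synonym 'a hypergraph = "'a set \<times> 'a set multiset"

definition split_hypergraph :: "'a set \<Rightarrow> 'a set \<Rightarrow> 'a set set \<Rightarrow> 'a hypergraph" where
  "split_hypergraph D I E = (D, image_mset (nbhd E) (mset_set I))"

definition uniform :: "nat \<Rightarrow> 'a hypergraph \<Rightarrow> bool" where
  "uniform k H \<longleftrightarrow> (\<forall>e\<in>#snd H. card e = k)"

(* Colours are total functions, but only their values on the vertices of H matter. *)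
definition panchromatic :: "nat \<Rightarrow> 'a hypergraph \<Rightarrow> ('a \<Rightarrow> nat) \<Rightarrow> bool" where
  "panchromatic k H c \<longleftrightarrow>
     c ` fst H \<subseteq> {1..k} \<and> (\<forall>e\<in>#snd H. \<forall>i\<in>{1..k}. \<exists>v\<in>e. c v = i)"

definition unique_color :: "'a hypergraph \<Rightarrow> ('a \<Rightarrow> nat) \<Rightarrow> nat \<Rightarrow> bool" where
  "unique_color H c i \<longleftrightarrow> (\<exists>!v. v \<in> fst H \<and> c v = i)"

definition num_unique :: "'a hypergraph \<Rightarrow> ('a \<Rightarrow> nat) \<Rightarrow> nat" where
  "num_unique H c = card {v \<in> fst H. unique_color H c (c v)}"

(* Meaningful only if H admits a panchromatic k-colouring. *)
definition alpha :: "nat \<Rightarrow> 'a hypergraph \<Rightarrow> nat" where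
  "alpha k H = (LEAST n. \<exists>c. panchromatic k H c \<and> num_unique H c = n)"

end

theory Submission
  imports Defs
begin

text \<open>Partition the vertices into groups, and let the inner vertices of the \<open>i\<close>-th tree lie in the \<open>i\<close>-th
  group. Such trees exist once every group is connected and, for any two groups, every vertex of
  either group can choose a neighbour in the other such that no two vertices choose each other: the
  choices make each vertex a leaf of all the other trees, and no edge is used twice.

  All of \<open>I\<close> may go into a single group, and the groups of the clique \<open>D\<close> are unions of colour
  classes, so every \<open>x \<in> I\<close> has a neighbour in each of them. Two groups with at least two clique
  vertices each span a 4-cycle, and orienting this cycle gives the choices; merging the unique
  colours in pairs makes all groups that large. In the second case the groups are the colour classes,
  \<open>I\<close> joins the unique vertex \<open>w\<close>, and the 4-cycle towards colour \<open>i\<close> runs through \<open>w\<close>, the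
  vertex \<open>y\<close> and its two neighbours of colour \<open>i\<close>.\<close>

section \<open>Rooted spanning trees encoded by parent maps\<close>

definition parent_edges :: "'a set \<Rightarrow> 'a \<Rightarrow> ('a \<Rightarrow> 'a) \<Rightarrow> 'a set set" where
  "parent_edges V r p = {{v, p v} |v. v \<in> V - {r}}"

lemma parent_edgesE:
  assumes "{v, w} \<in> parent_edges V r p"
  obtains "w = p v" | "w \<in> V - {r}" "v = p w"
  using assms unfolding parent_edges_def by (auto simp: doubleton_eq_iff)

text \<open>Paths must be free of repetitions: if \<open>z\<close> already lies on \<open>q\<close>,
  the path is cut off at \<open>z\<close>, otherwise \<open>z\<close> is appended.\<close>

lemma is_path_extend:
  assumes "is_path V T x q y" "z \<in> V" "{y, z} \<in> T"
  shows "\<exists>q'. is_path V T x q' z"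
proof (cases "z \<in> set q")
  case True
  then obtain n where n: "n < length q" "q ! n = z"
    by (auto simp: in_set_conv_nth)
  have "path_edges (take (Suc n) q) \<subseteq> path_edges q"
    unfolding path_edges_def by auto
  moreover have "set (take (Suc n) q) \<subseteq> set q"
    by (rule set_take_subset)
  moreover have "last (take (Suc n) q) = z"
    using n by (simp add: take_Suc_conv_app_nth)
  ultimately have "is_path V T x (take (Suc n) q) z"
    using assms n unfolding is_path_def by (auto simp: hd_take)
  then show ?thesis ..
next
  case False
  have "path_edges (q @ [z]) \<subseteq> insert {last q, z} (path_edges q)"
  proof
    fix e assume "e \<in> path_edges (q @ [z])"
    then obtain i where i: "i < length q" "e = {(q @ [z]) ! i, (q @ [z]) ! Suc i}"
      unfolding path_edges_def by auto
    show "e \<in> insert {last q, z} (path_edges q)"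
    proof (cases "Suc i < length q")
      case True
      then show ?thesis using i unfolding path_edges_def by (auto simp: nth_append)
    next
      case False
      then have len: "length q = Suc i" using i by simp
      then have "last q = q ! i" using last_conv_nth[of q] by force
      then show ?thesis using i len by (simp add: nth_append)
    qed
  qed
  then have "is_path V T x (q @ [z]) z"
    using assms False unfolding is_path_def by auto
  then show ?thesis ..
qed

lemma is_connected_if_rtrancl:
  assumes "\<And>x y. x \<in> V \<Longrightarrow> y \<in> V \<Longrightarrow> (x, y) \<in> {(y, z). z \<in> V \<and> {y, z} \<in> T}\<^sup>*"
  shows "is_connected V T"
  unfolding is_connected_def
proof (intro ballI)
  fix x y assume xy: "x \<in> V" "y \<in> V"
  from assms[OF xy] show "\<exists>q. is_path V T x q y"
  proof (induction rule: rtrancl_induct)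
    case base
    have "is_path V T x [x] x"
      using xy unfolding is_path_def path_edges_def by auto
    then show ?case ..
  next
    case (step y z)
    then show ?case by (auto intro: is_path_extend)
  qed
qed

text \<open>Serves to show that an internal vertex of a path in a tree is no leaf of that
  tree.\<close>

lemma internal_vert_neighbours:
  assumes "is_path V T x q y" "v \<in> internal_verts q"
  obtains a b where "a \<noteq> b" "{v, a} \<in> T" "{v, b} \<in> T"
proof -
  obtain n where n: "n < length q" "q ! n = v"
    using assms unfolding internal_verts_def by (auto simp: in_set_conv_nth)
  have "q \<noteq> []" "v \<noteq> hd q" "v \<noteq> last q"
    using assms unfolding internal_verts_def is_path_def by auto
  then have "n \<noteq> 0" "n \<noteq> length q - 1"
    using n by (metis hd_conv_nth, metis last_conv_nth)
  then obtain l where l: "n = Suc l" "Suc n < length q"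
    using n by (cases n) auto
  have "{q ! l, q ! Suc l} \<in> path_edges q" "{q ! n, q ! Suc n} \<in> path_edges q"
    using l unfolding path_edges_def by auto
  moreover have "q ! l \<noteq> q ! Suc n"
    using assms l unfolding is_path_def by (auto simp: nth_eq_iff_index_eq)
  ultimately show ?thesis
    using that[of "q ! l" "q ! Suc n"] n l assms unfolding is_path_def
    by (auto simp: insert_commute)
qed

lemma cycle_neighbours:
  assumes "is_cycle T q" "v \<in> set q"
  obtains a b where "a \<in> set q" "b \<in> set q" "a \<noteq> b" "{v, a} \<in> T" "{v, b} \<in> T"
proof -
  let ?n = "length q"
  have n3: "?n \<ge> 3" and dist: "distinct q" and sub: "path_edges q \<subseteq> T" and cl: "{last q, hd q} \<in> T"
    using assms unfolding is_cycle_def by auto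
  have ne: "q \<noteq> []" using n3 by auto
  have E: "{q ! l, q ! Suc l} \<in> T" if "Suc l < ?n" for l
    using sub that unfolding path_edges_def by auto
  have C: "{q ! (?n - 1), q ! 0} \<in> T"
    using cl ne by (simp add: last_conv_nth hd_conv_nth)
  have neq: "q ! a \<noteq> q ! b" if "a < ?n" "b < ?n" "a \<noteq> b" for a b
    using that dist by (simp add: nth_eq_iff_index_eq)
  obtain l where l: "l < ?n" "v = q ! l"
    using assms by (auto simp: in_set_conv_nth)
  \<comment> \<open>At either end of the list, one of the two neighbours comes from the closing edge
    \<open>C\<close>.\<close>
  consider "l = 0" | "l = ?n - 1" "l \<noteq> 0" | l' where "l = Suc l'" "Suc l < ?n"
    using l by (cases l) force+
  then show ?thesis
  proof cases
    case 1
    then show ?thesis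
      using that[of "q ! 1" "q ! (?n - 1)"] E[of 0] C l n3 neq[of 1 "?n - 1"]
      by (auto simp: insert_commute)
  next
    case 2
    have "Suc (?n - 2) = ?n - 1" using n3 by simp
    then show ?thesis
      using that[of "q ! (?n - 2)" "q ! 0"] E[of "?n - 2"] C l n3 2 neq[of "?n - 2" 0] ne
      by (simp add: insert_commute)
  next
    case 3
    then show ?thesis
      using that[of "q ! l'" "q ! Suc l"] E[of l'] E[of l] l neq[of l' "Suc l"]
      by (auto simp: insert_commute)
  qed
qed

text \<open>As \<open>rk\<close> decreases towards the parent, following parents ends at
  \<open>r\<close>, which gives connectedness. On a cycle, both neighbours of a vertex of largest
  rank would have to be its parent, although they differ.\<close>

lemma is_spanning_tree_parent_edges:
  fixes rk :: "'a \<Rightarrow> nat"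
  assumes r: "r \<in> V"
    and p: "\<And>v. v \<in> V - {r} \<Longrightarrow> p v \<in> V \<and> {v, p v} \<in> E \<and> rk (p v) < rk v"
  shows "is_spanning_tree V E (parent_edges V r p)"
  unfolding is_spanning_tree_def
proof (intro conjI)
  let ?T = "parent_edges V r p"
  let ?R = "{(y, z). z \<in> V \<and> {y, z} \<in> ?T}"
  show "?T \<subseteq> E"
    using p unfolding parent_edges_def by auto
  have to_root: "v \<in> V \<Longrightarrow> (v, r) \<in> ?R\<^sup>* \<and> (r, v) \<in> ?R\<^sup>*" for v
  proof (induction "rk v" arbitrary: v rule: less_induct)
    case less
    show ?case
    proof (cases "v = r")
      case False
      then have v: "v \<in> V - {r}" using less by auto
      then have "{v, p v} \<in> ?T" unfolding parent_edges_def by auto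
      then have "(v, p v) \<in> ?R" "(p v, v) \<in> ?R"
        using p[OF v] v by (auto simp: insert_commute)
      moreover have "(p v, r) \<in> ?R\<^sup>*" "(r, p v) \<in> ?R\<^sup>*"
        using less p[OF v] by blast+
      ultimately show ?thesis
        by (meson converse_rtrancl_into_rtrancl rtrancl.rtrancl_into_rtrancl)
    qed simp
  qed
  show "is_connected V ?T"
    by (rule is_connected_if_rtrancl) (rule rtrancl_trans[of _ r], use to_root in auto)
  show "\<nexists>q. is_cycle ?T q"
  proof
    assume "\<exists>q. is_cycle ?T q"
    then obtain q where q: "is_cycle ?T q" ..
    then have "q \<noteq> []" unfolding is_cycle_def by auto
    then have "Max (rk ` set q) \<in> rk ` set q" by (intro Max_in) auto
    then obtain v where v: "v \<in> set q" "rk v = Max (rk ` set q)" by (metis imageE)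
    have top: "rk w \<le> rk v" if "w \<in> set q" for w using that v(2) by simp
    obtain a b where ab: "a \<in> set q" "b \<in> set q" "a \<noteq> b" "{v, a} \<in> ?T" "{v, b} \<in> ?T"
      using cycle_neighbours[OF q v(1)] by blast
    have "w = p v" if "w \<in> set q" "{v, w} \<in> ?T" for w
      using that(2)
    proof (cases rule: parent_edgesE)
      case 2
      then show ?thesis using p[of w] top[OF that(1)] by auto
    qed
    then show False using ab by blast
  qed
qed

section \<open>Complete independence in terms of parent maps\<close>

text \<open>All parents in tree \<open>i\<close> lie in group \<open>i\<close>, so internal vertices
  of paths in different trees lie in different groups. For the same reason a common edge of two
  trees joins no vertex to a common parent; its ends would be each other's parents.\<close>

lemma has_CISTs_if_parents:
  fixes rk :: "nat \<Rightarrow> 'a \<Rightarrow> nat"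
  assumes r: "\<And>i. i \<in> {1..m} \<Longrightarrow> r i \<in> V"
    and p: "\<And>i v. i \<in> {1..m} \<Longrightarrow> v \<in> V - {r i} \<Longrightarrow>
        p i v \<in> V \<and> {v, p i v} \<in> E \<and> rk i (p i v) < rk i v \<and> g (p i v) = i"
    and no_swap: "\<And>i j u v. i \<in> {1..m} \<Longrightarrow> j \<in> {1..m} \<Longrightarrow> i \<noteq> j \<Longrightarrow> u \<in> V - {r i} \<Longrightarrow>
        v \<in> V - {r j} \<Longrightarrow> p i u = v \<Longrightarrow> p j v = u \<Longrightarrow> False"
  shows "has_CISTs V E m"
proof -
  define T where "T i = parent_edges V (r i) (p i)" for i
  have tree: "is_spanning_tree V E (T i)" if "i \<in> {1..m}" for i
    unfolding T_def using r p that by (intro is_spanning_tree_parent_edges[where rk = "rk i"]) auto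
  have disj: "T i \<inter> T j = {}" if ij: "i \<in> {1..m}" "j \<in> {1..m}" "i \<noteq> j" for i j
  proof (rule ccontr)
    assume "T i \<inter> T j \<noteq> {}"
    then obtain u v where uv: "u \<in> V - {r i}" "v \<in> V - {r j}" "{u, p i u} = {v, p j v}"
      unfolding T_def parent_edges_def by blast
    then have "p i u = p j v \<or> p i u = v \<and> p j v = u"
      unfolding doubleton_eq_iff by blast
    moreover have "p i u \<noteq> p j v"
      using p[OF ij(1) uv(1)] p[OF ij(2) uv(2)] ij(3) by metis
    ultimately show False using no_swap[OF ij uv(1,2)] by blast
  qed
  have inner: "g v = i" if i: "i \<in> {1..m}" and q: "is_path V (T i) x q y" "v \<in> internal_verts q"
    for i x y q v
  proof -
    obtain a b where ab: "a \<noteq> b" "{v, a} \<in> T i" "{v, b} \<in> T i"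
      using internal_vert_neighbours[OF q] .
    \<comment> \<open>At most one of the two neighbours is the parent of \<open>v\<close>, so the
      other is a child \<open>w\<close>.\<close>
    then obtain w where "w \<in> V - {r i}" "v = p i w"
      using parent_edgesE[of v _ V "r i" "p i"] unfolding T_def by metis
    then show ?thesis using p[OF i] by auto
  qed
  have "completely_independent V E m T"
    unfolding completely_independent_def
  proof (intro conjI ballI allI impI)
    fix i j x y q q'
    assume *: "i \<in> {1..m}" "j \<in> {1..m}" "i \<noteq> j" "is_path V (T i) x q y" "is_path V (T j) x q' y"
    show "path_edges q \<inter> path_edges q' = {}"
      using disj[OF *(1-3)] *(4,5) unfolding is_path_def by blast
    show "internal_verts q \<inter> internal_verts q' = {}"
      using inner[OF *(1,4)] inner[OF *(2,5)] *(3) by blast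
  qed (use tree in auto)
  then show ?thesis unfolding has_CISTs_def by blast
qed

section \<open>Trees in a split graph from a grouping of its vertices\<close>

lemma nbhd_independent_subset:
  assumes "split_graph D I E" "x \<in> I"
  shows "nbhd E x \<subseteq> D"
proof
  fix y assume "y \<in> nbhd E x"
  then have e: "{x, y} \<in> E" unfolding nbhd_def by simp
  then have "y \<in> D \<union> I"
    using assms(1) unfolding split_graph_def fin_simple_graph_def
    by (metis doubleton_eq_iff)
  then show "y \<in> D" using e assms unfolding split_graph_def by blast
qed

text \<open>In the spanning tree \<open>i\<close>, the inner vertices are those of group \<open>i\<close>, and every other vertex is
  a leaf. The group of a clique vertex is given by \<open>g\<close>; all independent vertices are in group \<open>s\<close>.
  Each \<open>x \<in> I\<close> hangs below \<open>h i x\<close>, and each clique vertex of another group below \<open>f i v\<close>.\<close>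

lemma split_graph_has_CISTs:
  assumes split: "split_graph D I E"
    and s: "s \<in> {1..m}"
    and r: "\<And>i. i \<in> {1..m} \<Longrightarrow> r i \<in> D \<and> g (r i) = i"
    and h: "\<And>i x. i \<in> {1..m} \<Longrightarrow> x \<in> I \<Longrightarrow> h i x \<in> nbhd E x \<and> g (h i x) = i"
    and f: "\<And>i v. i \<in> {1..m} \<Longrightarrow> v \<in> D \<Longrightarrow> g v \<noteq> i \<Longrightarrow>
        f i v \<in> D \<and> g (f i v) = i \<or> f i v \<in> I \<and> i = s \<and> v \<in> nbhd E (f i v)"
    and no_swap: "\<And>u v. u \<in> D \<Longrightarrow> v \<in> D \<Longrightarrow> g u \<in> {1..m} \<Longrightarrow> g v \<in> {1..m} \<Longrightarrow>
        g u \<noteq> g v \<Longrightarrow> f (g v) u = v \<Longrightarrow> f (g u) v = u \<Longrightarrow> False"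
    and no_swap_I: "\<And>x v. x \<in> I \<Longrightarrow> v \<in> D \<Longrightarrow> g v \<in> {1..m} \<Longrightarrow> g v \<noteq> s \<Longrightarrow>
        h (g v) x = v \<Longrightarrow> f s v = x \<Longrightarrow> False"
  shows "has_CISTs (D \<union> I) E m"
proof -
  define p where "p i v = (if v \<in> I then h i v else if g v = i then r i else f i v)" for i v
  \<comment> \<open>Ranks bound the depth: clique vertices of group \<open>i\<close> hang below the
    root, \<open>I\<close> below these, and the other clique vertices come last because for
    \<open>i = s\<close> they may hang below \<open>I\<close>.\<close>
  define rk :: "nat \<Rightarrow> 'a \<Rightarrow> nat" where
    "rk i v = (if v = r i then 0 else if v \<in> I then 2 else if g v = i then 1 else 3)" for i v
  define gr where "gr v = (if v \<in> I then s else g v)" for v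
  have DI: "v \<notin> I" if "v \<in> D" for v
    using split that unfolding split_graph_def by auto
  have clique: "{u, v} \<in> E" if "u \<in> D" "v \<in> D" "u \<noteq> v" for u v
    using split that unfolding split_graph_def by auto
  have hD: "h i x \<in> D" if "i \<in> {1..m}" "x \<in> I" for i x
    using h[OF that] nbhd_independent_subset[OF split that(2)] by auto
  have p_gr: "gr (p i v) = i" if "i \<in> {1..m}" "v \<in> D \<union> I" for i v
    using that h[of i v] hD[of i v] f[of i v] r[of i] DI unfolding gr_def p_def by auto
  show ?thesis
  proof (rule has_CISTs_if_parents[where r = r and p = p and rk = rk and g = gr])
    fix i assume "i \<in> {1..m}"
    then show "r i \<in> D \<union> I" using r by auto
  next
    fix i v assume i: "i \<in> {1..m}" and v: "v \<in> D \<union> I - {r i}"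
    consider "v \<in> I" | "v \<in> D" "g v = i" | "v \<in> D" "g v \<noteq> i" using v by auto
    then have "p i v \<in> D \<union> I \<and> {v, p i v} \<in> E \<and> rk i (p i v) < rk i v"
    proof cases
      case 1
      then show ?thesis
        using h[OF i 1] hD[OF i 1] DI[of "h i v"] r[OF i] DI[of "r i"]
        unfolding p_def rk_def nbhd_def by auto
    next
      case 2
      then show ?thesis
        using r[OF i] clique[of v "r i"] v DI[of v] unfolding p_def rk_def by auto
    next
      case 3
      have "v \<noteq> f i v" using f[OF i 3] 3 DI by auto
      moreover have "v \<noteq> r i" using 3 r[OF i] by auto
      ultimately show ?thesis
        using f[OF i 3] clique[of v "f i v"] 3 DI[of v] DI[of "f i v"]
        unfolding p_def rk_def nbhd_def by (auto simp: insert_commute)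
    qed
    then show "p i v \<in> D \<union> I \<and> {v, p i v} \<in> E \<and> rk i (p i v) < rk i v \<and> gr (p i v) = i"
      using p_gr i v by auto
  next
    fix i j u v
    assume ij: "i \<in> {1..m}" "j \<in> {1..m}" "i \<noteq> j"
      and uv: "u \<in> D \<union> I - {r i}" "v \<in> D \<union> I - {r j}" "p i u = v" "p j v = u"
    have gr: "gr v = i" "gr u = j"
      using p_gr[of i u] p_gr[of j v] ij uv by auto
    consider "u \<in> D" "v \<in> D" | "u \<in> I" "v \<in> D" | "u \<in> D" "v \<in> I" | "u \<in> I" "v \<in> I"
      using uv by auto
    then show False
    proof cases
      case 1
      then show ?thesis
        using no_swap[of u v] gr uv(3,4) ij DI[of u] DI[of v] unfolding gr_def p_def by auto
    next
      case 2
      then show ?thesis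
        using no_swap_I[of u v] gr uv(3,4) ij DI[of v] unfolding gr_def p_def by auto
    next
      case 3
      then show ?thesis
        using no_swap_I[of v u] gr uv(3,4) ij DI[of u] unfolding gr_def p_def by auto
    next
      case 4
      then show ?thesis using gr ij unfolding gr_def by auto
    qed
  qed
qed

section \<open>Groups with at least two clique vertices\<close>

text \<open>Between two groups with distinguished vertices \<open>a i \<noteq> b i\<close> and \<open>a j \<noteq> b j\<close>, \<open>i < j\<close>, the clique
  vertices follow the 4-cycle \<open>a i \<rightarrow> a j \<rightarrow> b i \<rightarrow> b j \<rightarrow> a i\<close>; the others point to \<open>a\<close>.\<close>

definition cross :: "('a \<Rightarrow> nat) \<Rightarrow> (nat \<Rightarrow> 'a) \<Rightarrow> (nat \<Rightarrow> 'a) \<Rightarrow> nat \<Rightarrow> 'a \<Rightarrow> 'a" where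
  "cross g a b t v =
     (if v = (if g v < t then b (g v) else a (g v)) then b t else a t)"

text \<open>Every value of \<open>cross\<close> is a distinguished vertex, so a swap would have both
  ends on the 4-cycle of the two groups, and this cycle is traversed in one direction only.\<close>

lemma cross_no_swap:
  assumes "g u \<noteq> g v" "a (g u) \<noteq> b (g u)" "a (g v) \<noteq> b (g v)"
    and "cross g a b (g v) u = v" "cross g a b (g u) v = u"
  shows False
proof -
  have "\<not> g u < g v"
  proof
    assume "g u < g v"
    then show False using assms(2-) unfolding cross_def by (smt (verit) not_less_iff_gr_or_eq)
  qed
  moreover have "\<not> g v < g u"
  proof
    assume "g v < g u"
    then show False using assms(2-) unfolding cross_def by (smt (verit) not_less_iff_gr_or_eq)
  qed
  ultimately show False using assms(1) by simp
qed

lemma has_CISTs_of_large_groups: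
  assumes split: "split_graph D I E"
    and m: "m \<ge> 1"
    and g: "g ` D \<subseteq> {1..m}"
    and large: "\<And>i. i \<in> {1..m} \<Longrightarrow> \<exists>a\<in>D. \<exists>b\<in>D. a \<noteq> b \<and> g a = i \<and> g b = i"
    and nb: "\<And>i x. i \<in> {1..m} \<Longrightarrow> x \<in> I \<Longrightarrow> \<exists>v\<in>nbhd E x. g v = i"
  shows "has_CISTs (D \<union> I) E m"
proof -
  obtain a b where ab: "\<And>i. i \<in> {1..m} \<Longrightarrow> a i \<in> D \<and> b i \<in> D \<and> a i \<noteq> b i \<and> g (a i) = i \<and> g (b i) = i"
    using large by metis
  obtain h where h: "\<And>i x. i \<in> {1..m} \<Longrightarrow> x \<in> I \<Longrightarrow> h i x \<in> nbhd E x \<and> g (h i x) = i"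
    using nb by metis
  have DI: "D \<inter> I = {}" using split unfolding split_graph_def by auto
  have crossD: "cross g a b i v \<in> D \<and> g (cross g a b i v) = i" if "i \<in> {1..m}" for i v
    using ab[OF that] unfolding cross_def by auto
  show ?thesis
  \<comment> \<open>Group 1 takes all of \<open>I\<close>. Since \<open>cross\<close> only yields
    clique vertices, no swap can involve a vertex of \<open>I\<close>.\<close>
  proof (rule split_graph_has_CISTs[where s = 1 and r = a and h = h and g = g and f = "cross g a b", OF split])
    fix u v assume "u \<in> D" "v \<in> D" "g u \<in> {1..m}" "g v \<in> {1..m}"
      "g u \<noteq> g v" "cross g a b (g v) u = v" "cross g a b (g u) v = u"
    then show False using cross_no_swap[of g u v a b] ab by blast
  next
    fix x v assume "x \<in> I" "cross g a b 1 v = x"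
    then show False using crossD[of 1 v] m DI by auto
  qed (use m ab h crossD in auto)
qed

section \<open>One group with a single clique vertex\<close>

lemma has_CISTs_of_one_small_group:
  assumes split: "split_graph D I E"
    and g: "g ` D \<subseteq> {1..m}"
    and s: "s \<in> {1..m}"
    and w: "w \<in> D" "g w = s" "\<And>v. v \<in> D \<Longrightarrow> g v = s \<Longrightarrow> v = w"
    and nb: "\<And>i x. i \<in> {1..m} \<Longrightarrow> x \<in> I \<Longrightarrow> \<exists>v\<in>nbhd E x. g v = i"
    and y: "\<And>i. i \<in> {1..m} \<Longrightarrow> i \<noteq> s \<Longrightarrow>
       \<exists>y\<in>I. \<exists>a\<in>nbhd E y. \<exists>b\<in>nbhd E y. a \<noteq> b \<and> g a = i \<and> g b = i"
  shows "has_CISTs (D \<union> I) E m"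
proof -
  have nbD: "v \<in> D" if "x \<in> I" "v \<in> nbhd E x" for x v
    using nbhd_independent_subset[OF split that(1)] that(2) by auto
  have DI: "D \<inter> I = {}" using split unfolding split_graph_def by auto
  \<comment> \<open>The conditions on \<open>i\<close> move inside the existential quantifiers so
    that \<open>choice_iff\<close> can turn the three vertices into functions of
    \<open>i\<close>.\<close>
  have "\<forall>i. \<exists>y a b. i \<in> {1..m} \<longrightarrow> i \<noteq> s \<longrightarrow>
      y \<in> I \<and> a \<in> nbhd E (y) \<and> b \<in> nbhd E (y) \<and> a \<noteq> b \<and> g (a) = i \<and> g (b) = i"
    using y by meson
  then have "\<exists>y a b. \<forall>i. i \<in> {1..m} \<longrightarrow> i \<noteq> s \<longrightarrow>
      y i \<in> I \<and> a i \<in> nbhd E (y i) \<and> b i \<in> nbhd E (y i) \<and> a i \<noteq> b i \<and> g (a i) = i \<and> g (b i) = i"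
    by (simp only: choice_iff)
  then obtain y a b where y: "\<And>i. i \<in> {1..m} \<Longrightarrow> i \<noteq> s \<Longrightarrow>
      y i \<in> I \<and> a i \<in> nbhd E (y i) \<and> b i \<in> nbhd E (y i) \<and> a i \<noteq> b i \<and> g (a i) = i \<and> g (b i) = i"
    by blast
  have abD: "a i \<in> D" "b i \<in> D" if "i \<in> {1..m}" "i \<noteq> s" for i
    using y[OF that] nbD by auto
  obtain h0 where h0: "\<And>i x. i \<in> {1..m} \<Longrightarrow> x \<in> I \<Longrightarrow> h0 i x \<in> nbhd E x \<and> g (h0 i x) = i"
    using nb by metis
  \<comment> \<open>Between groups \<open>s\<close> and \<open>i\<close> the 4-cycle is \<open>w \<rightarrow> a i \<rightarrow> y i \<rightarrow> b i \<rightarrow> w\<close>.\<close>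
  define h where "h i x = (if i \<noteq> s \<and> x = y i then b i else h0 i x)" for i x
  define f where "f i v = (if i = s then if v = a (g v) then y (g v) else w
      else if g v = s then a i else cross g a b i v)" for i v
  define r where "r i = (if i = s then w else a i)" for i
  show ?thesis
  proof (rule split_graph_has_CISTs[where s = s and r = r and h = h and g = g and f = f, OF split])
    fix i assume "i \<in> {1..m}"
    then show "r i \<in> D \<and> g (r i) = i" using w(1,2) y[of i] abD[of i] unfolding r_def by auto
  next
    fix i x assume "i \<in> {1..m}" "x \<in> I"
    then show "h i x \<in> nbhd E x \<and> g (h i x) = i" using h0[of i x] y[of i] unfolding h_def by auto
  next
    fix i v assume i: "i \<in> {1..m}" "v \<in> D" "g v \<noteq> i"
    then have "g v \<in> {1..m}" using g by auto
    then show "f i v \<in> D \<and> g (f i v) = i \<or> f i v \<in> I \<and> i = s \<and> v \<in> nbhd E (f i v)"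
      using i w(1,2) y[of i] y[of "g v"] abD[of i] unfolding f_def cross_def by auto
  next
    fix u v assume uv: "u \<in> D" "v \<in> D" "g u \<in> {1..m}" "g v \<in> {1..m}" "g u \<noteq> g v"
      "f (g v) u = v" "f (g u) v = u"
    consider "g u = s" "g v \<noteq> s" | "g v = s" "g u \<noteq> s" | "g u \<noteq> s" "g v \<noteq> s" using uv by auto
    then show False
    proof cases
      case 1
      \<comment> \<open>Here \<open>u\<close> chooses \<open>v = a (g v)\<close>, which in turn
        chooses a vertex of \<open>I\<close> and hence not \<open>u\<close>.\<close>
      then have "a (g v) = v" using uv(6) unfolding f_def by simp
      then have "y (g v) = u" using uv(7) 1 unfolding f_def by simp
      then show ?thesis using y[OF uv(4) 1(2)] DI uv(1) by auto
    next
      case 2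
      then have "a (g u) = u" using uv(7) unfolding f_def by simp
      then have "y (g u) = v" using uv(6) 2 unfolding f_def by simp
      then show ?thesis using y[OF uv(3) 2(2)] DI uv(2) by auto
    next
      case 3
      then have "cross g a b (g v) u = v" "cross g a b (g u) v = u"
        using uv(6,7) unfolding f_def by simp_all
      then show ?thesis using cross_no_swap[of g u v a b] uv(3-5) y[of "g u"] y[of "g v"] 3 by blast
    qed
  next
    fix x v assume x: "x \<in> I" "v \<in> D" "g v \<in> {1..m}" "g v \<noteq> s" "h (g v) x = v" "f s v = x"
    \<comment> \<open>Only \<open>a (g v)\<close> chooses a vertex of \<open>I\<close>, namely
      \<open>y (g v)\<close>; but \<open>h\<close> sends that vertex to
      \<open>b (g v)\<close>.\<close>
    then have "a (g v) = v" "y (g v) = x" using w(1) DI unfolding f_def by (auto split: if_splits)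
    then have "b (g v) = a (g v)" using x(4,5) unfolding h_def by simp
    then show False using y[OF x(3,4)] by simp
  qed (rule s)
qed

section \<open>Merging colours and counting unique ones\<close>

text \<open>Two unique colours are merged at a time, and a leftover one joins an arbitrary group.\<close>

lemma merge_colours:
  fixes U C :: "'c set"
  assumes "finite C" "U \<subseteq> C" "card C \<ge> 2"
  obtains q where "q ` C \<subseteq> {1..card C - card U + card U div 2}"
    and "\<And>t. t \<in> {1..card C - card U + card U div 2} \<Longrightarrow>
      (\<exists>i\<in>C - U. q i = t) \<or> (\<exists>i\<in>C. \<exists>j\<in>C. i \<noteq> j \<and> q i = t \<and> q j = t)"
proof -
  define n where "n = card C - card U"
  define d where "d = card U"
  define m where "m = n + d div 2"
  have finU: "finite U" using assms finite_subset by blast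
  obtain e where e: "bij_betw e U {0..<d}"
    unfolding d_def using ex_bij_betw_finite_nat[OF finU] by blast
  have "card (C - U) = n"
    unfolding n_def using assms finU by (simp add: card_Diff_subset)
  then obtain e' where e': "bij_betw e' (C - U) {0..<n}"
    using ex_bij_betw_finite_nat[of "C - U"] assms by auto
  have "n + d \<ge> 2" unfolding n_def d_def using assms card_mono[of C U] by simp
  then have m: "m \<ge> 1" unfolding m_def by linarith
  \<comment> \<open>The unique colours numbered \<open>2 * l\<close> and \<open>2 * l + 1\<close>
    share group \<open>l + 1\<close>; the other colours get one group each after these. For odd
    \<open>d\<close> the last unique colour joins the next group, and if \<open>n = 0\<close> there
    is none, so \<open>mod m\<close> sends it back to group 1.\<close>
  define q where "q i = Suc (if i \<in> U then (e i div 2) mod m else d div 2 + e' i)" for i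
  have "q ` C \<subseteq> {1..m}"
  proof
    fix t assume "t \<in> q ` C"
    then obtain i where i: "i \<in> C" "t = q i" by auto
    have "e' i < n" if "i \<notin> U" using bij_betwE[OF e'] i that by auto
    moreover have "(e i div 2) mod m < m" using m by simp
    ultimately show "t \<in> {1..m}"
      using i unfolding q_def m_def by auto
  qed
  moreover have "(\<exists>i\<in>C - U. q i = t) \<or> (\<exists>i\<in>C. \<exists>j\<in>C. i \<noteq> j \<and> q i = t \<and> q j = t)"
    if t: "t \<in> {1..m}" for t
  proof (cases "t - 1 < d div 2")
    case True
    then have "2 * (t - 1) \<in> {0..<d}" "2 * (t - 1) + 1 \<in> {0..<d}" by auto
    then obtain i j where ij: "i \<in> U" "e i = 2 * (t - 1)" "j \<in> U" "e j = 2 * (t - 1) + 1"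
      unfolding bij_betw_imp_surj_on[OF e, symmetric] by (metis imageE)
    have "t - 1 < m" "Suc (t - 1) = t" using t by auto
    moreover have "e i div 2 = t - 1" "e j div 2 = t - 1" using ij(2,4) by simp_all
    ultimately have "q i = t" "q j = t" using ij(1,3) unfolding q_def by simp_all
    moreover have "i \<noteq> j" using ij(2,4) by auto
    ultimately show ?thesis using ij assms(2) by blast
  next
    case False
    then have "t - 1 - d div 2 \<in> {0..<n}" using t unfolding m_def by auto
    then obtain i where i: "i \<in> C - U" "e' i = t - 1 - d div 2"
      unfolding bij_betw_imp_surj_on[OF e', symmetric] by (metis imageE)
    then have "q i = t" using False t unfolding q_def by auto
    then show ?thesis using i by blast
  qed
  ultimately show ?thesis
    unfolding m_def n_def d_def by (rule that)
qed

text \<open>\<open>num_unique\<close> counts vertices, whereas merging needs the number of colours;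
  \<open>c\<close> is injective on the uniquely coloured vertices.\<close>

lemma card_unique_colours:
  assumes "c ` fst H \<subseteq> C"
  shows "card {i \<in> C. unique_color H c i} = num_unique H c"
proof -
  let ?V = "{v \<in> fst H. unique_color H c (c v)}"
  have image: "c ` ?V = {i \<in> C. unique_color H c i}"
  proof
    show "c ` ?V \<subseteq> {i \<in> C. unique_color H c i}" using assms by auto
    show "{i \<in> C. unique_color H c i} \<subseteq> c ` ?V"
    proof
      fix i assume i: "i \<in> {i \<in> C. unique_color H c i}"
      then obtain v where "v \<in> fst H" "c v = i" unfolding unique_color_def by auto
      with i show "i \<in> c ` ?V" by auto
    qed
  qed
  have inj: "inj_on c ?V"
    by (rule inj_onI) (auto simp: unique_color_def)
  show ?thesis
    unfolding num_unique_def image[symmetric] by (rule card_image[OF inj])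
qed

lemma panchromatic_split_hypergraph:
  assumes "split_graph D I E"
  shows "panchromatic k (split_hypergraph D I E) c \<longleftrightarrow>
    c ` D \<subseteq> {1..k} \<and> (\<forall>x\<in>I. \<forall>i\<in>{1..k}. \<exists>v\<in>nbhd E x. c v = i)"
proof -
  have "finite I" using assms unfolding split_graph_def fin_simple_graph_def by auto
  then show ?thesis unfolding panchromatic_def split_hypergraph_def by simp
qed

lemma has_CISTs_empty: "has_CISTs {} E m"
proof -
  have "is_path {} T x p y \<Longrightarrow> False" for T and x y :: 'a and p
    unfolding is_path_def by auto
  moreover have "\<not> is_cycle {} p" for p :: "'a list"
  proof
    assume "is_cycle {} p"
    then show False unfolding is_cycle_def by simp
  qed
  ultimately have "completely_independent {} E m (\<lambda>_. {})"
    unfolding completely_independent_def is_spanning_tree_def is_connected_def by auto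
  then show ?thesis unfolding has_CISTs_def by blast
qed

theorem theorem6:
  fixes D I :: "'a set" and E :: "'a set set" and k :: nat
  defines "H \<equiv> split_hypergraph D I E"
  defines "\<alpha> \<equiv> alpha k H"
  assumes "k \<ge> 2"
    and "split_graph D I E"
    and "\<forall>v\<in>D. \<exists>x\<in>I. {v, x} \<in> E"
    and "\<exists>c. panchromatic k H c"
  shows "has_CISTs (D \<union> I) E (k - nat \<lceil>real \<alpha> / 2\<rceil>) \<and>
    (\<not> uniform k H \<and>
     (\<exists>c. panchromatic k H c \<and> num_unique H c = \<alpha> \<and>
       (\<exists>j\<in>{1..k}. {i \<in> {1..k}. unique_color H c i} = {j} \<and>
         (\<forall>i\<in>{1..k}. i \<noteq> j \<longrightarrow>
           (\<exists>y\<in>I. degree E y > k \<and> card {v \<in> nbhd E y. c v = i} \<ge> 2))))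
     \<longrightarrow> has_CISTs (D \<union> I) E (k - nat \<lceil>real \<alpha> / 2\<rceil> + 1))"
proof -
  note split = \<open>split_graph D I E\<close>
  note pan = panchromatic_split_hypergraph[OF split, of k, folded H_def]
  have fstH: "fst H = D" unfolding H_def split_hypergraph_def by simp
  obtain c where c: "panchromatic k H c" "num_unique H c = \<alpha>"
    using LeastI_ex[of "\<lambda>n. \<exists>c. panchromatic k H c \<and> num_unique H c = n"] assms(6)
    unfolding \<alpha>_def alpha_def by blast
  show ?thesis
  proof (cases "I = {}")
    \<comment> \<open>Without hyperedges a panchromatic colouring need not use every colour, so this
      case is separate. Every clique vertex has a neighbour in \<open>I\<close>, hence the graph is
      empty.\<close>
    case True
    then have "D \<union> I = {}" using assms(5) by auto
    then show ?thesis using has_CISTs_empty by metis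
  next
    case False
    have color_ex: "\<exists>v\<in>D. c' v = i" if "panchromatic k H c'" "i \<in> {1..k}" for c' i
      using that False nbhd_independent_subset[OF split] unfolding pan by blast
    have nonunique: "\<exists>a\<in>D. \<exists>b\<in>D. a \<noteq> b \<and> c' a = i \<and> c' b = i"
      if "panchromatic k H c'" "i \<in> {1..k}" "\<not> unique_color H c' i" for c' i
      using color_ex[OF that(1,2)] that(3) unfolding unique_color_def fstH by blast
    define U where "U = {i \<in> {1..k}. unique_color H c i}"
    have cardU: "card U = \<alpha>"
      unfolding U_def c(2)[symmetric] using c(1) pan fstH by (intro card_unique_colours) simp
    have "U \<subseteq> {1..k}" unfolding U_def by auto
    then have "\<alpha> \<le> k" using card_mono[of "{1..k}" U] cardU by simp
    have "nat \<lceil>real \<alpha> / 2\<rceil> = (\<alpha> + 1) div 2"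
      by linarith
    \<comment> \<open>This counts one group per colour that is not unique and one per pair of unique
      colours.\<close>
    then have m: "k - nat \<lceil>real \<alpha> / 2\<rceil> = k - \<alpha> + \<alpha> div 2"
      using \<open>\<alpha> \<le> k\<close> by linarith
    let ?m = "k - \<alpha> + \<alpha> div 2"
    obtain q where q: "q ` {1..k} \<subseteq> {1..?m}"
      and large: "\<And>t. t \<in> {1..?m} \<Longrightarrow> (\<exists>i\<in>{1..k} - U. q i = t) \<or>
        (\<exists>i\<in>{1..k}. \<exists>j\<in>{1..k}. i \<noteq> j \<and> q i = t \<and> q j = t)"
      using merge_colours[of "{1..k}" U] \<open>U \<subseteq> {1..k}\<close> \<open>k \<ge> 2\<close> unfolding cardU card_atLeastAtMost diff_Suc_1 by blast
    have "has_CISTs (D \<union> I) E ?m"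
    proof (rule has_CISTs_of_large_groups[where g = "q \<circ> c", OF split])
      show "?m \<ge> 1" using \<open>\<alpha> \<le> k\<close> \<open>k \<ge> 2\<close> by linarith
      show "(q \<circ> c) ` D \<subseteq> {1..?m}"
        using q c(1) unfolding pan image_subset_iff comp_apply by blast
    next
      fix t assume "t \<in> {1..?m}"
      from large[OF this] show "\<exists>a\<in>D. \<exists>b\<in>D. a \<noteq> b \<and> (q \<circ> c) a = t \<and> (q \<circ> c) b = t"
      proof (elim disjE bexE conjE)
        fix i assume i: "i \<in> {1..k} - U" "q i = t"
        then have "i \<in> {1..k}" "\<not> unique_color H c i" unfolding U_def by simp_all
        then obtain a b where ab: "a \<in> D" "b \<in> D" "a \<noteq> b" "c a = i" "c b = i"
          using nonunique[OF c(1)] by meson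
        have "(q \<circ> c) a = t" "(q \<circ> c) b = t" using ab(4,5) i(2) by simp_all
        then show ?thesis using ab(1-3) by (intro bexI[of _ a] bexI[of _ b] conjI)
      next
        fix i j assume ij: "i \<in> {1..k}" "j \<in> {1..k}" "i \<noteq> j" "q i = t" "q j = t"
        obtain a b where ab: "a \<in> D" "c a = i" "b \<in> D" "c b = j"
          using color_ex[OF c(1)] ij(1,2) by meson
        have "(q \<circ> c) a = t" "(q \<circ> c) b = t" "a \<noteq> b" using ab(2,4) ij(3-5) by auto
        then show ?thesis using ab(1,3) by (intro bexI[of _ a] bexI[of _ b] conjI)
      qed
    next
      fix t x assume t: "t \<in> {1..?m}" and "x \<in> I"
      from large[OF t] obtain i where "i \<in> {1..k}" "q i = t" by blast
      moreover from this(1) obtain v where "v \<in> nbhd E x" "c v = i"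
        using c(1) \<open>x \<in> I\<close> unfolding pan by blast
      ultimately show "\<exists>v\<in>nbhd E x. (q \<circ> c) v = t" by auto
    qed
    moreover have "has_CISTs (D \<union> I) E (?m + 1)"
      if c': "panchromatic k H c'" "num_unique H c' = \<alpha>" and j: "j \<in> {1..k}"
        and only: "{i \<in> {1..k}. unique_color H c' i} = {j}"
        and y: "\<forall>i\<in>{1..k}. i \<noteq> j \<longrightarrow> (\<exists>y\<in>I. degree E y > k \<and> card {v \<in> nbhd E y. c' v = i} \<ge> 2)"
      for c' j
    proof -
      have "\<alpha> = 1"
        using card_unique_colours[of c' H "{1..k}"] c' only pan fstH by simp
      \<comment> \<open>With a single unique colour \<open>\<alpha> div 2\<close> is 0, and the
        \<open>k\<close> colour classes themselves serve as groups.\<close>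
      then have "?m + 1 = k" using \<open>k \<ge> 2\<close> by simp
      have "unique_color H c' j" using only by blast
      then obtain w where w: "w \<in> D" "c' w = j" "\<And>v. v \<in> D \<Longrightarrow> c' v = j \<Longrightarrow> v = w"
        unfolding unique_color_def fstH by blast
      have "has_CISTs (D \<union> I) E k"
      proof (rule has_CISTs_of_one_small_group[where g = c', OF split _ j w])
        fix i assume "i \<in> {1..k}" "i \<noteq> j"
        then obtain y where y: "y \<in> I" "card {v \<in> nbhd E y. c' v = i} \<ge> 2"
          using y by blast
        then obtain S where "S \<subseteq> {v \<in> nbhd E y. c' v = i}" "card S = 2"
          by (meson obtain_subset_with_card_n)
        then show "\<exists>y\<in>I. \<exists>a\<in>nbhd E y. \<exists>b\<in>nbhd E y. a \<noteq> b \<and> c' a = i \<and> c' b = i"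
          using y(1) unfolding card_2_iff by blast
      qed (use c'(1) pan in blast)+
      then show ?thesis using \<open>?m + 1 = k\<close> by simp
    qed
    ultimately show ?thesis unfolding m by blast
  qed
qed

end
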